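(* Let $D$ be a reduced knot diagram. Click path moves induce bijections between perfect discrete Morse functions on $\Gamma(D,v_w,v_b)$ and perfect discrete Morse functions on $\Gamma(D,v_w',v_b')$, for any pairs of white/black vertices $(v_w,v_b)$ and $(v_w',v_b')$ in $V(G_w)\times V(G_b)$. Moreover, at most two such moves are always sufficient (to transform a perfect discrete Morse function on the first graph into its image on the second).
   Context: Setting. $D$ is (the projection of) a knot diagram with at least one crossing, viewed as a connected 4-valent graph on $S^2$, with a chequerboard black/white colouring of the regions. $D$ is reduced if it has no nugatory crossing, i.e. no crossing has the same region at two of its four corners. The black graph $G_b$ has the black regions as vertices and one edge for each crossing, joining the two black regions opposite each other at that crossing; the white graph $G_w$ is defined analogously and is the plane dual of $G_b$. The overlaid Tait graph $\Gamma(D)$ is the superimposition of $G_b$ and $G_w$ on $S^2$: its vertices are the black regions, the white regions and the crossings, and its edges are the half-edges of $G_b$ and $G_w$, each joining a region to an incident crossing. $\Gamma(D,v_w,v_b)$ is $\Gamma(D)$ with the vertices $v_w\in V(G_w)$ and $v_b\in V(G_b)$ removed. $\Xi(D)$ is the cell structure on $S^2$ with 2-cells the white regions, 1-cells the crossings, 0-cells the black regions. Its poset graph is $\Gamma(D)$, with edges oriented from white vertices to crossings and from crossings to black vertices. A discrete Morse function means an equivalence class of such functions, i.e. a matching on $\Gamma(D)$ that is acyclic: reversing the orientation of all matched edges yields a directed graph without directed cycles. It is perfect if exactly one 0-cell and one 2-cell are unmatched (critical). A perfect discrete Morse function on $\Gamma(D,v_w,v_b)$ is one whose critical cells are exactly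 $v_w$ and $v_b$. For a matching $x$, $H_x^b\subset G_b$ is the spanning subgraph whose edges correspond to the crossings matched by $x$ with a black region; $H^w_x\subset G_w$ is defined analogously. For a perfect discrete Morse function these are spanning trees. Click path move: matchings $x$ and $x'$ pairing all crossings, with unmatched regions $(v_w,v_b)$ and $(v_w,v_b')$ respectively, differ by a click path move if they induce the same unrooted tree on $G_b$ and coincide everywhere except on the unique path of this tree connecting $v_b$ to $v_b'$. Analogously with the colours exchanged. *)

theory Defs
  imports "HOL-Combinatorics.Orbits"
begin

section \<open>Undirected multigraphs\<close>

text \<open>Loops and parallel edges are allowed: \<open>ends G e\<close> has one element if \<open>e\<close> is a loop and
  two otherwise.  (The notion of tree in the AFP entry on graph theory refers to directed cycles
  and does not fit undirected multigraphs.)\<close>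

record ('v, 'e) multigraph =
  verts :: "'v set"
  edges :: "'e set"
  ends  :: "'e \<Rightarrow> 'v set"

text \<open>A walk from \<open>u\<close> is the list of its steps; a step is the edge taken and the vertex reached.\<close>

fun is_walk :: "('v, 'e) multigraph \<Rightarrow> 'v \<Rightarrow> ('e \<times> 'v) list \<Rightarrow> 'v \<Rightarrow> bool" where
  "is_walk G u [] v \<longleftrightarrow> u \<in> verts G \<and> u = v"
| "is_walk G u ((e, w) # p) v \<longleftrightarrow>
     u \<in> verts G \<and> e \<in> edges G \<and> ends G e = {u, w} \<and> is_walk G w p v"

definition is_path :: "('v, 'e) multigraph \<Rightarrow> 'v \<Rightarrow> ('e \<times> 'v) list \<Rightarrow> 'v \<Rightarrow> bool" where
  "is_path G u p v \<longleftrightarrow> is_walk G u p v \<and> distinct (u # map snd p)"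

text \<open>Distinctness of the edges matters for cycles of length two, which must use two parallel
  edges.\<close>

definition is_cycle :: "('v, 'e) multigraph \<Rightarrow> 'v \<Rightarrow> ('e \<times> 'v) list \<Rightarrow> bool" where
  "is_cycle G u p \<longleftrightarrow>
     is_walk G u p u \<and> p \<noteq> [] \<and> distinct (map fst p) \<and> distinct (map snd p)"

definition is_tree :: "('v, 'e) multigraph \<Rightarrow> bool" where
  "is_tree G \<longleftrightarrow> verts G \<noteq> {} \<and> (\<forall>u\<in>verts G. \<forall>v\<in>verts G. \<exists>p. is_walk G u p v) \<and>
     (\<nexists>u p. is_cycle G u p)"

definition is_matching :: "('v, 'e) multigraph \<Rightarrow> 'e set \<Rightarrow> bool" where
  "is_matching G M \<longleftrightarrow> M \<subseteq> edges G \<and> (\<forall>d\<in>M. \<forall>e\<in>M. d \<noteq> e \<longrightarrow> ends G d \<inter> ends G e = {})"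

definition unmatched :: "('v, 'e) multigraph \<Rightarrow> 'e set \<Rightarrow> 'v set" where
  "unmatched G M = verts G - \<Union> (ends G ` M)"


section \<open>Knot diagrams\<close>

text \<open>A connected 4-valent graph on the sphere is encoded, as usual, by a combinatorial map.  The
  elements of \<open>darts\<close> are the half-edges of the diagram; \<open>mate\<close> exchanges the two halves of an
  edge, and \<open>rot\<close> sends a dart to the counterclockwise next one at the same crossing.  A dart \<open>d\<close>
  also stands for a corner, namely the one between \<open>d\<close> and \<open>rot d\<close>.  The field \<open>black\<close> is the set
  of black regions.\<close>

record 'd diagram =
  darts :: "'d set"
  rot   :: "'d \<Rightarrow> 'd"
  mate  :: "'d \<Rightarrow> 'd"
  black :: "'d set set"

definition crossing :: "'d diagram \<Rightarrow> 'd \<Rightarrow> 'd set" where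
  "crossing D d = orbit (rot D) d"

text \<open>The corner \<open>d\<close> lies to the left of \<open>d\<close> as seen when leaving the crossing.  Walking along \<open>d\<close>
  with the region on the left, the next corner of the region is the one between
  \<open>inv rot (mate d)\<close> and \<open>mate d\<close>.\<close>

definition region :: "'d diagram \<Rightarrow> 'd \<Rightarrow> 'd set" where
  "region D d = orbit (inv (rot D) \<circ> mate D) d"

definition crossings :: "'d diagram \<Rightarrow> 'd set set" where
  "crossings D = crossing D ` darts D"

definition regions :: "'d diagram \<Rightarrow> 'd set set" where
  "regions D = region D ` darts D"

definition white :: "'d diagram \<Rightarrow> 'd set set" where
  "white D = regions D - black D"

definition strands :: "'d diagram \<Rightarrow> 'd set set" where
  "strands D = (\<lambda>d. {d, mate D d}) ` darts D"

definition four_valent_map :: "'d diagram \<Rightarrow> bool" where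
  "four_valent_map D \<longleftrightarrow>
     finite (darts D) \<and> rot D permutes darts D \<and> mate D permutes darts D \<and>
     (\<forall>d\<in>darts D. mate D d \<noteq> d \<and> mate D (mate D d) = d) \<and>
     (\<forall>d\<in>darts D. card (crossing D d) = 4)"

definition connected_map :: "'d diagram \<Rightarrow> bool" where
  "connected_map D \<longleftrightarrow> (\<forall>d\<in>darts D. \<forall>e\<in>darts D. (\<lambda>x y. y = rot D x \<or> y = mate D x)\<^sup>*\<^sup>* d e)"

text \<open>For a connected map: the underlying closed surface has Euler characteristic 2.\<close>

definition spherical :: "'d diagram \<Rightarrow> bool" where
  "spherical D \<longleftrightarrow> card (crossings D) + card (regions D) = card (strands D) + 2"

text \<open>A traveller leaving along \<open>d\<close> arrives at the next crossing on \<open>mate d\<close> and goes straight on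
  along \<open>rot (rot (mate d))\<close>.  The diagram has one component if every edge is traversed, in
  one direction or the other.\<close>

definition one_component :: "'d diagram \<Rightarrow> bool" where
  "one_component D \<longleftrightarrow>
     (\<forall>d\<in>darts D. let T = orbit (rot D \<circ> rot D \<circ> mate D) d in darts D = T \<union> mate D ` T)"

text \<open>The regions on the two sides of an edge are \<open>region d\<close> and \<open>region (mate d)\<close>.\<close>

definition chequerboard :: "'d diagram \<Rightarrow> bool" where
  "chequerboard D \<longleftrightarrow> black D \<subseteq> regions D \<and>
     (\<forall>d\<in>darts D. region D d \<in> black D \<longleftrightarrow> region D (mate D d) \<notin> black D)"

definition knot_diagram :: "'d diagram \<Rightarrow> bool" where
  "knot_diagram D \<longleftrightarrow> darts D \<noteq> {} \<and> four_valent_map D \<and> connected_map D \<and> spherical D \<and>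
     one_component D \<and> chequerboard D"

definition reduced :: "'d diagram \<Rightarrow> bool" where
  "reduced D \<longleftrightarrow> (\<forall>c\<in>crossings D. inj_on (region D) c)"


section \<open>Tait graphs and the overlaid Tait graph\<close>

text \<open>The Tait graph on the regions of one colour class \<open>R\<close>.  The two corners of a crossing whose
  region is in \<open>R\<close> are opposite each other.\<close>

definition tait_graph :: "'d diagram \<Rightarrow> 'd set set \<Rightarrow> ('d set, 'd set) multigraph" where
  "tait_graph D R = \<lparr>verts = R, edges = crossings D, ends = (\<lambda>c. region D ` c \<inter> R)\<rparr>"

abbreviation black_graph :: "'d diagram \<Rightarrow> ('d set, 'd set) multigraph" where
  "black_graph D \<equiv> tait_graph D (black D)"

abbreviation white_graph :: "'d diagram \<Rightarrow> ('d set, 'd set) multigraph" where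
  "white_graph D \<equiv> tait_graph D (white D)"

datatype 'd cell = Region "'d set" | Crossing "'d set"

text \<open>The edges of the overlaid Tait graph are the corners of the diagram.\<close>

definition overlaid_graph :: "'d diagram \<Rightarrow> ('d cell, 'd) multigraph" where
  "overlaid_graph D =
     \<lparr>verts = Region ` regions D \<union> Crossing ` crossings D,
      edges = darts D,
      ends = (\<lambda>d. {Region (region D d), Crossing (crossing D d)})\<rparr>"


section \<open>Discrete Morse functions\<close>

text \<open>The edges of the overlaid Tait graph are oriented from white regions to crossings and from
  crossings to black regions, that is, from 2-cells to 1-cells and from 1-cells to 0-cells.\<close>

definition arrow :: "'d diagram \<Rightarrow> 'd \<Rightarrow> 'd cell \<times> 'd cell" where
  "arrow D d = (if region D d \<in> black D then (Crossing (crossing D d), Region (region D d))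
     else (Region (region D d), Crossing (crossing D d)))"

definition modified_arrows :: "'d diagram \<Rightarrow> 'd set \<Rightarrow> ('d cell \<times> 'd cell) set" where
  "modified_arrows D x = arrow D ` (darts D - x) \<union> (arrow D ` x)\<inverse>"

definition discrete_morse :: "'d diagram \<Rightarrow> 'd set \<Rightarrow> bool" where
  "discrete_morse D x \<longleftrightarrow> is_matching (overlaid_graph D) x \<and> acyclic (modified_arrows D x)"

abbreviation critical :: "'d diagram \<Rightarrow> 'd set \<Rightarrow> 'd cell set" where
  "critical D x \<equiv> unmatched (overlaid_graph D) x"

text \<open>The perfect discrete Morse functions on the overlaid Tait graph with \<open>vw\<close> and \<open>vb\<close> removed.\<close>

definition perfect_morse :: "'d diagram \<Rightarrow> 'd set \<Rightarrow> 'd set \<Rightarrow> 'd set set" where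
  "perfect_morse D vw vb = {x. discrete_morse D x \<and> critical D x = {Region vw, Region vb}}"


section \<open>Click path moves\<close>

text \<open>The spanning subgraph of the Tait graph on \<open>R\<close> whose edges are the crossings that \<open>x\<close> matches
  with a region in \<open>R\<close>.\<close>

definition matched_subgraph ::
    "'d diagram \<Rightarrow> 'd set set \<Rightarrow> 'd set \<Rightarrow> ('d set, 'd set) multigraph" where
  "matched_subgraph D R x =
     (tait_graph D R)\<lparr>edges := crossing D ` {d \<in> x. region D d \<in> R}\<rparr>"

text \<open>Moves that leave the unmatched region \<open>u\<close> of the other colour in place and move the one in \<open>R\<close>
  from \<open>v\<close> to \<open>v'\<close>.  That every crossing is paired is part of the equations for \<open>critical\<close>.\<close>

definition click_on :: "'d diagram \<Rightarrow> 'd set set \<Rightarrow> 'd set \<Rightarrow> 'd set \<Rightarrow> bool" where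
  "click_on D R x x' \<longleftrightarrow>
     is_matching (overlaid_graph D) x \<and> is_matching (overlaid_graph D) x' \<and>
     (\<exists>u \<in> regions D - R. \<exists>v\<in>R. \<exists>v'\<in>R.
        critical D x = {Region u, Region v} \<and> critical D x' = {Region u, Region v'} \<and>
        matched_subgraph D R x = matched_subgraph D R x' \<and>
        is_tree (matched_subgraph D R x) \<and>
        (\<exists>p. is_path (matched_subgraph D R x) v p v' \<and>
             {d \<in> x. crossing D d \<notin> set (map fst p)} = {d \<in> x'. crossing D d \<notin> set (map fst p)}))"

definition click_path_move :: "'d diagram \<Rightarrow> 'd set \<Rightarrow> 'd set \<Rightarrow> bool" where
  "click_path_move D x x' \<longleftrightarrow> click_on D (black D) x x' \<or> click_on D (white D) x x'"

end

theory Submission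
  imports Defs
begin

text \<open>In the directed graph of modified arrows, one can pass from white to black but never back: the
  only way out of a black region is the crossing matched with it, and from there one reaches the
  opposite black region.  A directed cycle therefore stays in one colour, and acyclicity means that
  \<open>region \<mapsto> opposite region at the matched crossing\<close> is the parent function of a rooted tree, for
  the black and the white regions separately.  A rooted tree is determined by its root and its edges,
  and every vertex can be made the root by turning around the path to the old root, which is a click
  path move.  So one black and one white move lead from any pair of roots to any other, and the set
  of crossings matched with black regions, an invariant of all moves, determines the image.\<close>

section \<open>Walks in multigraphs\<close>

lemma is_walk_append:
  "is_walk G u p v \<Longrightarrow> is_walk G v q w \<Longrightarrow> is_walk G u (p @ q) w"
  by (induction p arbitrary: u) auto

lemma is_walk_end_verts: "is_walk G u p v \<Longrightarrow> v \<in> verts G"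
  by (induction p arbitrary: u) auto

lemma is_walk_snoc:
  assumes "is_walk G u p v" "e \<in> edges G" "ends G e = {v, w}" "w \<in> verts G"
  shows "is_walk G u (p @ [(e, w)]) w"
  using assms by (auto intro!: is_walk_append dest: is_walk_end_verts)

lemma is_walk_reverse: "is_walk G u p v \<Longrightarrow> \<exists>q. is_walk G v q u"
proof (induction p arbitrary: u)
  case Nil
  then show ?case by (auto intro: exI[of _ "[]"])
next
  case (Cons s p)
  obtain e w where "s = (e, w)" by force
  with Cons.prems have *: "u \<in> verts G" "e \<in> edges G" "ends G e = {w, u}" "is_walk G w p v"
    by (auto simp: insert_commute)
  with Cons.IH obtain q where "is_walk G v q w" by blast
  from is_walk_snoc[OF this *(2,3,1)] show ?case ..
qed

lemma is_walk_ends_subset: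
  "is_walk G u p v \<Longrightarrow> e \<in> fst ` set p \<Longrightarrow> e \<in> edges G \<and> ends G e \<subseteq> insert u (snd ` set p)"
proof (induction p arbitrary: u)
  case (Cons s p)
  obtain d w where s: "s = (d, w)" by force
  show ?case
  proof (cases "e \<in> fst ` set p")
    case True
    from Cons.prems(1) s have "is_walk G w p v" by simp
    from Cons.IH[OF this True] s show ?thesis by auto
  next
    case False
    with Cons.prems s show ?thesis by auto
  qed
qed simp

lemma is_walk_end_mem: "is_walk G u p v \<Longrightarrow> p \<noteq> [] \<Longrightarrow> v \<in> snd ` set p"
proof (induction p arbitrary: u)
  case (Cons s p)
  then show ?case by (cases s; cases p) auto
qed simp

section \<open>Rooted spanning trees described by half-edges\<close>

text \<open>An abstract setting that both Tait graphs instantiate: \<open>vx\<close> is the vertex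
  at which a half-edge starts, \<open>ed\<close> its edge, \<open>opp\<close> the other half of that
  edge. Orienting an edge of a tree towards the root amounts to choosing one of its halves. The
  assumption \<open>vx_opp\<close> excludes loops.\<close>

locale half_edge_graph =
  fixes G :: "('v, 'e) multigraph" and H :: "'h set"
    and vx :: "'h \<Rightarrow> 'v" and ed :: "'h \<Rightarrow> 'e" and opp :: "'h \<Rightarrow> 'h"
  assumes finite_H: "finite H"
    and vx_verts: "h \<in> H \<Longrightarrow> vx h \<in> verts G"
    and opp_H: "h \<in> H \<Longrightarrow> opp h \<in> H"
    and opp_opp: "h \<in> H \<Longrightarrow> opp (opp h) = h"
    and ed_opp: "h \<in> H \<Longrightarrow> ed (opp h) = ed h"
    and vx_opp: "h \<in> H \<Longrightarrow> vx (opp h) \<noteq> vx h"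
    and ed_eqD: "h \<in> H \<Longrightarrow> k \<in> H \<Longrightarrow> ed h = ed k \<Longrightarrow> h = k \<or> h = opp k"
    and ends_ed: "h \<in> H \<Longrightarrow> ends G (ed h) = {vx h, vx (opp h)}"
begin

definition parent_rel :: "'h set \<Rightarrow> ('v \<times> 'v) set" where
  "parent_rel y = (\<lambda>h. (vx h, vx (opp h))) ` y"

text \<open>A set of half-edges picks one edge at each vertex other than the root, the edge to its
  parent.\<close>

definition rooted :: "'v \<Rightarrow> 'h set \<Rightarrow> bool" where
  "rooted v y \<longleftrightarrow> y \<subseteq> H \<and> v \<in> verts G \<and> inj_on ed y \<and> inj_on vx y \<and>
     vx ` y = verts G - {v} \<and> acyclic (parent_rel y)"

lemma rooted_subset: "rooted v y \<Longrightarrow> y \<subseteq> H"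
  by (simp add: rooted_def)

lemma rooted_opp_notin:
  assumes "rooted v y" "h \<in> y"
  shows "opp h \<notin> y"
proof
  assume "opp h \<in> y"
  with assms have "opp h = h"
    by (auto simp: rooted_def dest!: inj_onD[of ed y "opp h" h] intro: ed_opp)
  with assms show False using vx_opp by (force simp: rooted_def)
qed

lemma rooted_wf:
  assumes "rooted v y"
  shows "wf ((parent_rel y)\<inverse>)"
  using assms finite_subset[OF _ finite_H]
  by (intro finite_acyclic_wf_converse) (auto simp: rooted_def parent_rel_def)

text \<open>Induction from the root outwards, from parent to child. It is sound because a finite
  acyclic parent relation admits no infinite ascent.\<close>

lemma rooted_induct [consumes 2, case_names root step]:
  assumes "rooted v y" "u \<in> verts G" "P v" "\<And>h. h \<in> y \<Longrightarrow> P (vx (opp h)) \<Longrightarrow> P (vx h)"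
  shows "P u"
  using rooted_wf[OF assms(1)] assms(2)
proof (induction u rule: wf_induct_rule)
  case (less u)
  show ?case
  proof (cases "u = v")
    case False
    with less.prems assms(1) have "u \<in> vx ` y" by (simp add: rooted_def)
    then obtain h where h: "h \<in> y" "u = vx h" by blast
    then have "vx (opp h) \<in> verts G"
      using assms(1) vx_verts opp_H by (auto simp: rooted_def)
    with h less.IH show ?thesis by (auto simp: parent_rel_def intro: assms(4))
  qed (use assms(3) in simp)
qed

text \<open>A cycle has as many edges as vertices, so each of its vertices is the child end of one of its
  edges; hence the vertices of the cycle are closed under taking parents.\<close>

lemma rooted_no_cycle:
  assumes "rooted v y" and cyc: "is_cycle (G\<lparr>edges := ed ` y\<rparr>) u p"
  shows False
proof -
  let ?T = "G\<lparr>edges := ed ` y\<rparr>" and ?S = "snd ` set p"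
  have w: "is_walk ?T u p u" and ne: "p \<noteq> []"
    and d: "distinct (map fst p)" "distinct (map snd p)"
    using cyc by (auto simp: is_cycle_def)
  define y0 where "y0 = {h \<in> y. ed h \<in> fst ` set p}"
  have uS: "insert u ?S = ?S" using is_walk_end_mem[OF w ne] by blast
  have sub: "e \<in> ed ` y \<and> ends G e \<subseteq> ?S" if "e \<in> fst ` set p" for e
    using is_walk_ends_subset[OF w that] uS by simp
  have inj: "inj_on ed y0" "inj_on vx y0" and yH: "y0 \<subseteq> H"
    using assms(1) by (auto simp: rooted_def y0_def intro: inj_on_subset)
  have "card y0 = card (fst ` set p)"
  proof -
    have "e \<in> ed ` y0" if "e \<in> fst ` set p" for e
    proof -
      from sub[OF that] have "e \<in> ed ` y" ..
      then obtain h where "h \<in> y" "e = ed h" ..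
      with that show ?thesis by (simp add: y0_def)
    qed
    then have "ed ` y0 = fst ` set p" by (auto simp: y0_def)
    with card_image[OF inj(1)] show ?thesis by simp
  qed
  also have "\<dots> = card ?S"
    using distinct_card[OF d(1)] distinct_card[OF d(2)] by simp
  finally have "card (vx ` y0) = card ?S" using card_image[OF inj(2)] by simp
  moreover have in_S: "vx h \<in> ?S \<and> vx (opp h) \<in> ?S" if "h \<in> y0" for h
  proof -
    from that yH have "h \<in> H" by blast
    moreover from that have "ends G (ed h) \<subseteq> ?S" using sub by (simp add: y0_def)
    ultimately show ?thesis by (simp add: ends_ed)
  qed
  ultimately have S: "vx ` y0 = ?S" by (intro card_subset_eq) auto
  have "?S \<noteq> {}" using ne by simp
  \<comment> \<open>A vertex of the cycle that is minimal for the well-founded relation: its parent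
    cannot lie on the cycle.\<close>
  then obtain s where s: "s \<in> ?S" "\<And>t. (t, s) \<in> (parent_rel y)\<inverse> \<Longrightarrow> t \<notin> ?S"
    using rooted_wf[OF assms(1)] unfolding wf_eq_minimal by (metis ex_in_conv)
  then obtain h where "h \<in> y0" "s = vx h" using S by blast
  with s(2)[of "vx (opp h)"] in_S show False
    by (auto simp: parent_rel_def y0_def)
qed

text \<open>Following parents joins every vertex to the root, and walks can be reversed, so any two
  vertices are connected through the root.\<close>

lemma rooted_is_tree:
  assumes "rooted v y"
  shows "is_tree (G\<lparr>edges := ed ` y\<rparr>)"
proof -
  let ?T = "G\<lparr>edges := ed ` y\<rparr>"
  have v: "v \<in> verts G" using assms by (simp add: rooted_def)
  have to_root: "\<exists>p. is_walk ?T u p v" if "u \<in> verts G" for u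
    using assms that
  proof (induction rule: rooted_induct)
    case root
    with v show ?case by (auto intro: exI[of _ "[]"])
  next
    case (step h)
    then obtain p where "is_walk ?T (vx (opp h)) p v" by blast
    moreover have "h \<in> H" using step(1) assms by (auto simp: rooted_def)
    ultimately have "is_walk ?T (vx h) ((ed h, vx (opp h)) # p) v"
      using step(1) by (simp add: ends_ed vx_verts)
    then show ?case ..
  qed
  have "\<exists>p. is_walk ?T u p w" if u: "u \<in> verts G" and w: "w \<in> verts G" for u w
  proof -
    obtain p where "is_walk ?T u p v" using to_root[OF u] by blast
    moreover obtain q where "is_walk ?T w q v" using to_root[OF w] by blast
    from is_walk_reverse[OF this] obtain q' where "is_walk ?T v q' w" by blast
    ultimately show ?thesis by (blast intro: is_walk_append)
  qed
  with v rooted_no_cycle[OF assms] show ?thesis unfolding is_tree_def by auto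
qed

text \<open>Going outwards from the root, each half-edge \<open>k\<close> of \<open>y\<close> is
  shown to lie in \<open>z\<close>. Otherwise \<open>z\<close> uses the same edge as
  \<open>opp k\<close>, so the parent of \<open>k\<close> is not the root and has its own half-edge
  \<open>j\<close> in \<open>y\<close>. By induction \<open>j\<close> is in \<open>z\<close>, which
  forces \<open>j = opp k\<close>, but \<open>y\<close> never contains both halves of an edge.
  Equality follows by counting edges.\<close>

lemma rooted_unique:
  assumes y: "rooted v y" and z: "rooted v z" and eq: "ed ` y = ed ` z"
  shows "y = z"
proof -
  have "h \<in> z" if "u \<in> verts G" "h \<in> y" "vx h = u" for u h
    using y that
  proof (induction arbitrary: h rule: rooted_induct)
    case root
    with y show ?case by (auto simp: rooted_def)
  next
    case (step k)
    have hk: "h = k" using y step by (auto simp: rooted_def dest: inj_onD)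
    have kH: "k \<in> H" using y step by (auto simp: rooted_def)
    obtain m where m: "m \<in> z" "ed m = ed k" using eq step(1) by (metis image_iff)
    show ?case
    proof (rule ccontr)
      assume "h \<notin> z"
      then have oz: "opp k \<in> z"
        using m hk kH ed_eqD[of m k] z by (auto simp: rooted_def)
      then have "vx (opp k) \<noteq> v" using z by (auto simp: rooted_def)
      then have "vx (opp k) \<in> vx ` y" using y kH vx_verts opp_H by (simp add: rooted_def)
      then obtain j where j: "j \<in> y" "vx j = vx (opp k)" by force
      with step(2) have "j \<in> z" by blast
      with oz j z have "j = opp k" by (auto simp: rooted_def dest: inj_onD)
      with j rooted_opp_notin[OF y step(1)] show False by simp
    qed
  qed
  then have "y \<subseteq> z" using y vx_verts by (auto simp: rooted_def)
  moreover have "card y = card z"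
    using y z eq card_image[of ed y] card_image[of ed z] by (simp add: rooted_def)
  moreover have "finite z" using z finite_H by (auto simp: rooted_def intro: finite_subset)
  ultimately show ?thesis by (simp add: card_subset_eq)
qed

text \<open>The root moves to one of its children when the single edge between them is turned
  around.\<close>

lemma rooted_reroot_step:
  assumes y: "rooted u y" and h: "h \<in> y" "vx (opp h) = u"
  shows "rooted (vx h) (insert (opp h) (y - {h}))"
proof -
  let ?y = "insert (opp h) (y - {h})" and ?r = "parent_rel (y - {h})"
  have H: "h \<in> H" "y \<subseteq> H" using y h by (auto simp: rooted_def)
  have o: "opp h \<notin> y" using rooted_opp_notin[OF y h(1)] .
  have img: "vx ` (y - {h}) = verts G - {u, vx h}"
    using y h(1) inj_on_image_set_diff[of vx y y "{h}"] by (auto simp: rooted_def)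
  have ed_img: "ed ` (y - {h}) = ed ` y - {ed h}"
    using y h(1) inj_on_image_set_diff[of ed y y "{h}"] by (auto simp: rooted_def)
  have "inj_on ed (y - {h})" "inj_on vx (y - {h})"
    using y by (auto simp: rooted_def intro: inj_on_subset)
  then have inj: "inj_on ed ?y" "inj_on vx ?y"
    using img ed_img h(2) o H(1) by (auto simp: ed_opp inj_on_insert)
  have u: "u \<in> verts G" "u \<noteq> vx h" using y h H vx_opp by (auto simp: rooted_def)
  have acy: "acyclic ?r"
    using y by (auto simp: rooted_def parent_rel_def intro: acyclic_subset)
  \<comment> \<open>With \<open>h\<close> removed, no step leaves \<open>vx h\<close>, so the added
    step from \<open>u\<close> to \<open>vx h\<close> closes no cycle.\<close>
  have "vx h \<notin> Domain ?r" using img by (auto simp: parent_rel_def Domain_fst image_image)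
  then have "(vx h, u) \<notin> ?r\<^sup>*" using u(2) by (auto elim: converse_rtranclE)
  moreover have "parent_rel ?y = insert (u, vx h) ?r"
    using h(2) H opp_opp by (simp add: parent_rel_def)
  ultimately have "acyclic (parent_rel ?y)" using acy by (simp add: acyclic_insert)
  moreover have "vx ` ?y = verts G - {vx h}" using img h(2) u by auto
  ultimately show ?thesis using inj H opp_H vx_verts unfolding rooted_def by auto
qed

text \<open>The root is pushed down the tree towards \<open>v'\<close> one edge at a time; only the
  edges passed on the way are turned around.\<close>

lemma rooted_reroot:
  assumes y: "rooted v y" and v': "v' \<in> verts G"
  obtains z p where "rooted v' z" "ed ` z = ed ` y" "is_path (G\<lparr>edges := ed ` y\<rparr>) v p v'"
    "{h \<in> y. ed h \<notin> set (map fst p)} = {h \<in> z. ed h \<notin> set (map fst p)}"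
proof -
  let ?T = "G\<lparr>edges := ed ` y\<rparr>"
  \<comment> \<open>The last conjunct strengthens the induction: all vertices of \<open>p\<close>
    are ancestors of \<open>v'\<close> or \<open>v'\<close> itself, so by acyclicity a further child
    extends \<open>p\<close> without repeating a vertex.\<close>
  have "\<exists>z p. rooted v' z \<and> ed ` z = ed ` y \<and> is_path ?T v p v' \<and>
      {h \<in> y. ed h \<notin> set (map fst p)} = {h \<in> z. ed h \<notin> set (map fst p)} \<and>
      (\<forall>w\<in>set (v # map snd p). (v', w) \<in> (parent_rel y)\<^sup>*)"
    using y v'
  proof (induction rule: rooted_induct)
    case root
    then show ?case using y
      by (intro exI[of _ y] exI[of _ "[]"]) (auto simp: is_path_def rooted_def)
  next
    case (step h)
    let ?u = "vx (opp h)"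
    from step(2) obtain z p where z: "rooted ?u z" "ed ` z = ed ` y" and p: "is_path ?T v p ?u"
      and agree: "{h \<in> y. ed h \<notin> set (map fst p)} = {h \<in> z. ed h \<notin> set (map fst p)}"
      and anc: "\<forall>w\<in>set (v # map snd p). (?u, w) \<in> (parent_rel y)\<^sup>*"
      by blast
    have H: "h \<in> H" using y step(1) by (auto simp: rooted_def)
    obtain m where m: "m \<in> z" "ed m = ed h" using z(2) step(1) by (metis image_iff)
    \<comment> \<open>The half-edge \<open>opp h\<close> starts at the root of \<open>z\<close>,
      where no half-edge of \<open>z\<close> starts; hence \<open>z\<close> still contains
      \<open>h\<close> itself.\<close>
    have "m \<noteq> opp h" using z(1) m(1) by (auto simp: rooted_def)
    then have hz: "h \<in> z" using m H ed_eqD[of m h] z(1) by (auto simp: rooted_def)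
    let ?z = "insert (opp h) (z - {h})" and ?p = "p @ [(ed h, vx h)]"
    have "rooted (vx h) ?z" using rooted_reroot_step[OF z(1) hz] by simp
    moreover have "ed ` ?z = ed ` y" using hz H z(2) ed_opp by (auto simp: image_iff)
    moreover have rel: "(vx h, ?u) \<in> parent_rel y" using step(1) by (simp add: parent_rel_def)
    have anc': "\<forall>w\<in>set (v # map snd p). (vx h, w) \<in> (parent_rel y)\<^sup>+"
      using anc rel by (meson rtrancl_into_trancl2)
    have "vx h \<notin> set (v # map snd p)"
      using anc' y by (meson acyclic_def rooted_def)
    then have "is_path ?T v ?p (vx h)"
      using p H step(1)
      by (auto simp: is_path_def ends_ed vx_verts insert_commute intro!: is_walk_snoc)
    moreover have "{h \<in> y. ed h \<notin> set (map fst ?p)} = {h \<in> ?z. ed h \<notin> set (map fst ?p)}"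
      using agree H ed_opp by auto
    moreover have "\<forall>w\<in>set (v # map snd ?p). (vx h, w) \<in> (parent_rel y)\<^sup>*"
      using anc' by (auto simp: trancl_into_rtrancl)
    ultimately show ?case by blast
  qed
  with that show ?thesis by blast
qed

end

section \<open>Auxiliary facts on cells and acyclic relations\<close>

lemma Diff_eq_swap: "A \<subseteq> C \<Longrightarrow> B \<subseteq> C \<Longrightarrow> C - A = B \<longleftrightarrow> A = C - B"
  by auto

lemma cell_image_eq_iff:
  "Region ` A \<union> Crossing ` B = Region ` A' \<union> Crossing ` B' \<longleftrightarrow> A = A' \<and> B = B'"
proof
  assume eq: "Region ` A \<union> Crossing ` B = Region ` A' \<union> Crossing ` B'"
  have "A = Region -` (Region ` A \<union> Crossing ` B)" "B = Crossing -` (Region ` A \<union> Crossing ` B)"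
    by auto
  then show "A = A' \<and> B = B'" unfolding eq by auto
qed simp

lemma acyclic_transport:
  assumes "acyclic s" "\<And>a b. (a, b) \<in> r \<Longrightarrow> (f a, f b) \<in> s\<^sup>+"
  shows "acyclic r"
proof (rule acyclicI, intro allI notI)
  fix a assume "(a, a) \<in> r\<^sup>+"
  moreover have "(f a, f b) \<in> s\<^sup>+" if "(a, b) \<in> r\<^sup>+" for a b
    using that by (induction rule: trancl_induct) (blast intro: assms(2) trancl_trans)+
  ultimately have "(f a, f a) \<in> s\<^sup>+" by blast
  with assms(1) show False by (simp add: acyclic_def)
qed

lemma acyclic_if_decreasing:
  fixes f :: "'a \<Rightarrow> nat"
  assumes "\<And>a b. (a, b) \<in> r \<Longrightarrow> f b < f a"
  shows "acyclic r"
proof -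
  have "acyclic (r\<inverse>)"
    by (rule acyclic_subset[OF wf_acyclic[OF wf_measure[of f]]]) (auto intro: assms)
  then show ?thesis by simp
qed

lemma finite_acyclic_decreasing:
  assumes "finite r" "acyclic r"
  shows "\<exists>f :: 'a \<Rightarrow> nat. \<forall>a b. (a, b) \<in> r \<longrightarrow> f b < f a"
\<comment> \<open>The witness stays schematic until the last line: it counts the elements reachable
  in at least one step. Along a pair this number drops, since \<open>b\<close> is reachable from
  \<open>a\<close> but not from itself.\<close>
proof (intro exI allI impI)
  fix a b assume ab: "(a, b) \<in> r"
  have "finite {c. (a, c) \<in> r\<^sup>+}"
    by (rule finite_subset[of _ "snd ` (r\<^sup>+)"]) (use assms(1) in force)+
  moreover have "{c. (b, c) \<in> r\<^sup>+} \<subset> {c. (a, c) \<in> r\<^sup>+}"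
  proof
    show "{c. (b, c) \<in> r\<^sup>+} \<subseteq> {c. (a, c) \<in> r\<^sup>+}" using ab by (auto intro: trancl_into_trancl2)
    show "{c. (b, c) \<in> r\<^sup>+} \<noteq> {c. (a, c) \<in> r\<^sup>+}"
      using ab assms(2) by (auto simp: acyclic_def set_eq_iff)
  qed
  ultimately show "card {c. (b, c) \<in> r\<^sup>+} < card {c. (a, c) \<in> r\<^sup>+}" by (rule psubset_card_mono)
qed

section \<open>Corners, crossings and colours of a reduced diagram\<close>

locale reduced_diagram =
  fixes D :: "'d diagram"
  assumes knot_diagram: "knot_diagram D" and reduced: "reduced D"
begin

abbreviation across :: "'d \<Rightarrow> 'd" where
  "across d \<equiv> rot D (rot D d)"

lemma finite_darts: "finite (darts D)"
  and rot_permutes: "rot D permutes darts D"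
  and mate_permutes: "mate D permutes darts D"
  and card_crossing: "d \<in> darts D \<Longrightarrow> card (crossing D d) = 4"
  and black_subset: "black D \<subseteq> regions D"
  and black_mate: "d \<in> darts D \<Longrightarrow> region D (mate D d) \<in> black D \<longleftrightarrow> region D d \<notin> black D"
  using knot_diagram by (auto simp: knot_diagram_def four_valent_map_def chequerboard_def)

lemma permutation_rot: "permutation (rot D)"
  using finite_darts rot_permutes by (auto simp: permutation_permutes)

lemma rot_darts: "d \<in> darts D \<Longrightarrow> rot D d \<in> darts D"
  using rot_permutes by (simp add: permutes_in_image)

lemma region_in_regions: "d \<in> darts D \<Longrightarrow> region D d \<in> regions D"
  by (simp add: regions_def)

lemma crossing_in_crossings: "d \<in> darts D \<Longrightarrow> crossing D d \<in> crossings D"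
  by (simp add: crossings_def)

lemma crossing_rot: "crossing D (rot D d) = crossing D d"
  by (simp add: crossing_def permutation_orbit_step permutation_rot)

lemma crossing_eqD: "crossing D d = crossing D e \<Longrightarrow> d \<in> crossing D e"
  unfolding crossing_def by (metis permutation_rot permutation_self_in_orbit)

text \<open>The orbit of \<open>d\<close> under \<open>rot D\<close> has four elements, so its
  period \<open>?n\<close> is four; the second power is therefore an involution without a fixed
  point on the crossing.\<close>

lemma four_corners:
  assumes "d \<in> darts D"
  shows "crossing D d = {d, rot D d, across d, across (rot D d)}"
    and "across (across d) = d" and "across d \<noteq> d"
proof -
  let ?n = "funpow_dist1 (rot D) d d"
  have self: "d \<in> orbit (rot D) d" by (simp add: permutation_rot permutation_self_in_orbit)
  have c: "crossing D d = (\<lambda>n. (rot D ^^ n) d) ` {0..<?n}"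
    using orbit_conv_funpow_dist1[OF self] by (simp add: crossing_def)
  then have n: "?n = 4"
    using card_crossing[OF assms] card_image[OF inj_on_funpow_dist1[OF self]] by simp
  show "across (across d) = d"
    using funpow_dist1_prop[OF self] n by (simp add: eval_nat_numeral)
  have "(rot D ^^ 2) d \<noteq> d"
    using funpow_dist1_least[of 2 "rot D" d d] n by simp
  then show "across d \<noteq> d" by (simp add: eval_nat_numeral)
  have "{0..<4::nat} = {0, 1, 2, 3}" by auto
  then show "crossing D d = {d, rot D d, across d, across (rot D d)}"
    using c n by (simp add: eval_nat_numeral)
qed

text \<open>The corners \<open>d\<close> and \<open>mate D (rot D d)\<close> are consecutive in one
  region. Passing from \<open>d\<close> to \<open>rot D d\<close> thus crosses a strand, and the
  chequerboard colouring changes there.\<close>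

lemma region_rot:
  assumes "d \<in> darts D"
  shows "region D (rot D d) \<in> black D \<longleftrightarrow> region D d \<notin> black D"
proof -
  let ?f = "inv (rot D) \<circ> mate D" and ?e = "mate D (rot D d)"
  have perm: "permutation ?f"
    using permutation_rot permutes_imp_permutation[OF finite_darts mate_permutes]
    by (intro permutation_compose permutation_inverse)
  have r: "rot D d \<in> darts D" using assms by (rule rot_darts)
  have "mate D ?e = rot D d"
    using knot_diagram r by (simp add: knot_diagram_def four_valent_map_def)
  then have "?f ?e = d" using permutes_inj[OF rot_permutes] by simp
  then have "region D ?e = region D d"
    using permutation_orbit_step[OF perm, of ?e] by (simp add: region_def)
  with black_mate[OF r] show ?thesis by auto
qed

lemma region_across:
  "d \<in> darts D \<Longrightarrow> region D (across d) \<in> black D \<longleftrightarrow> region D d \<in> black D"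
  using region_rot rot_darts by simp

text \<open>Colours alternate around a crossing, so its corners of a given colour are just one
  opposite pair.\<close>

lemma same_crossing:
  assumes "d \<in> darts D" "e \<in> darts D" "crossing D d = crossing D e"
    and "region D d \<in> black D \<longleftrightarrow> region D e \<in> black D"
  shows "d = e \<or> d = across e"
  using crossing_eqD[OF assms(3)] four_corners(1)[OF assms(2)] assms region_rot region_across
    rot_darts by auto

text \<open>This is where reducedness enters: it says that the Tait graphs have no loops.\<close>

lemma region_across_neq:
  assumes "d \<in> darts D"
  shows "region D (across d) \<noteq> region D d"
proof -
  have "inj_on (region D) (crossing D d)"
    using reduced crossing_in_crossings[OF assms] by (simp add: reduced_def)
  then show ?thesis using four_corners[OF assms] by (auto dest: inj_onD)
qed

text \<open>Serves to treat black and white at once, with \<open>regions D - R\<close> as the other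
  colour.\<close>

definition colour :: "'d set set \<Rightarrow> bool" where
  "colour R \<longleftrightarrow> R = black D \<or> R = white D"

lemma colour_compl: "colour R \<Longrightarrow> colour (regions D - R)"
  using black_subset by (auto simp: colour_def white_def)

lemma colour_subset: "colour R \<Longrightarrow> R \<subseteq> regions D"
  using black_subset by (auto simp: colour_def white_def)

lemma colour_iff:
  assumes "colour R" "d \<in> darts D" "e \<in> darts D"
    and "region D d \<in> black D \<longleftrightarrow> region D e \<in> black D"
  shows "region D d \<in> R \<longleftrightarrow> region D e \<in> R"
  using assms region_in_regions by (auto simp: colour_def white_def)

definition corners_in :: "'d set set \<Rightarrow> 'd set \<Rightarrow> 'd set" where
  "corners_in R x = {d \<in> x. region D d \<in> R}"

lemma same_crossing_colour:
  assumes "colour R" "d \<in> corners_in R (darts D)" "e \<in> corners_in R (darts D)"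
    and "crossing D d = crossing D e"
  shows "d = e \<or> d = across e"
  using assms by (intro same_crossing) (auto simp: colour_def white_def corners_in_def)

lemma across_corners_in:
  assumes "colour R" "d \<in> corners_in R (darts D)"
  shows "across d \<in> corners_in R (darts D)"
  using assms colour_iff[OF assms(1), of "across d" d] region_across[of d]
  by (auto simp: corners_in_def rot_darts)

text \<open>The half-edges of a Tait graph are the corners of its colour, and opposite corners form
  one edge.\<close>

lemma half_edge_graph_tait:
  assumes R: "colour R"
  shows "half_edge_graph (tait_graph D R) (corners_in R (darts D)) (region D) (crossing D) across"
proof
  fix h assume h: "h \<in> corners_in R (darts D)"
  then have hD: "h \<in> darts D" "region D h \<in> R" by (auto simp: corners_in_def)
  have nR: "region D e \<notin> R" if "e = rot D h \<or> e = across (rot D h)" for e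
  proof -
    have "e \<in> darts D" "region D e \<in> black D \<longleftrightarrow> region D h \<notin> black D"
      using that region_rot region_across rot_darts hD by auto
    then show ?thesis using R hD by (auto simp: colour_def white_def)
  qed
  show "across h \<in> corners_in R (darts D)" using across_corners_in[OF R h] .
  then have "region D (across h) \<in> R" by (simp add: corners_in_def)
  with hD nR show "ends (tait_graph D R) (crossing D h) = {region D h, region D (across h)}"
    by (auto simp: tait_graph_def four_corners(1))
  show "region D h \<in> verts (tait_graph D R)" using hD by (simp add: tait_graph_def)
  show "across (across h) = h" "region D (across h) \<noteq> region D h"
    using hD four_corners region_across_neq by auto
next
  show "finite (corners_in R (darts D))" using finite_darts by (simp add: corners_in_def)
qed (auto simp: crossing_rot dest: same_crossing_colour[OF R])

section \<open>Matchings as pairs of rooted trees\<close>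

abbreviation tait_rooted :: "'d set set \<Rightarrow> 'd set \<Rightarrow> 'd set \<Rightarrow> bool" where
  "tait_rooted R \<equiv>
     half_edge_graph.rooted (tait_graph D R) (corners_in R (darts D)) (region D) (crossing D) across"

text \<open>This is \<open>parent_rel\<close> for the Tait graphs; the same formula serves both
  colours.\<close>

definition step_rel :: "'d set \<Rightarrow> ('d set \<times> 'd set) set" where
  "step_rel y = (\<lambda>d. (region D d, region D (across d))) ` y"

lemma tait_rooted_iff:
  assumes "colour R"
  shows "tait_rooted R v y \<longleftrightarrow> y \<subseteq> corners_in R (darts D) \<and> v \<in> R \<and> inj_on (crossing D) y \<and>
    inj_on (region D) y \<and> region D ` y = R - {v} \<and> acyclic (step_rel y)"
  using half_edge_graph.rooted_def[OF half_edge_graph_tait[OF assms]]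
    half_edge_graph.parent_rel_def[OF half_edge_graph_tait[OF assms]]
  by (simp add: step_rel_def tait_graph_def)

text \<open>A perfect discrete Morse function is a pair of rooted spanning trees of the two Tait graphs
  in which every crossing is used exactly once.\<close>

definition tree_pair :: "'d set set \<Rightarrow> 'd set \<Rightarrow> 'd set \<Rightarrow> 'd set \<Rightarrow> bool" where
  "tree_pair R v u x \<longleftrightarrow> x \<subseteq> darts D \<and> inj_on (crossing D) x \<and> crossing D ` x = crossings D \<and>
     tait_rooted R v (corners_in R x) \<and> tait_rooted (regions D - R) u (corners_in (regions D - R) x)"

lemma tree_pair_swap:
  assumes "colour R"
  shows "tree_pair (regions D - R) u v x \<longleftrightarrow> tree_pair R v u x"
proof -
  have "regions D - (regions D - R) = R" using colour_subset[OF assms] by blast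
  then show ?thesis by (auto simp: tree_pair_def)
qed

lemma is_matching_overlaid_iff:
  "is_matching (overlaid_graph D) x \<longleftrightarrow>
     x \<subseteq> darts D \<and> inj_on (crossing D) x \<and> inj_on (region D) x"
  by (auto simp: is_matching_def overlaid_graph_def inj_on_def)

lemma critical_eq_iff:
  assumes "x \<subseteq> darts D" "u \<in> regions D" "v \<in> regions D"
  shows "critical D x = {Region u, Region v} \<longleftrightarrow>
    crossing D ` x = crossings D \<and> region D ` x = regions D - {u, v}"
proof -
  have "critical D x =
      Region ` (regions D - region D ` x) \<union> Crossing ` (crossings D - crossing D ` x)"
    by (auto simp: unmatched_def overlaid_graph_def)
  moreover have "{Region u, Region v} = Region ` {u, v} \<union> Crossing ` {}" by simp
  ultimately have crit: "critical D x = {Region u, Region v} \<longleftrightarrow>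
      regions D - region D ` x = {u, v} \<and> crossings D - crossing D ` x = {}"
    by (simp only: cell_image_eq_iff)
  have "regions D - region D ` x = {u, v} \<longleftrightarrow> region D ` x = regions D - {u, v}"
    using assms region_in_regions by (intro Diff_eq_swap) auto
  moreover have "crossings D - crossing D ` x = {} \<longleftrightarrow> crossing D ` x = crossings D"
    using assms(1) crossing_in_crossings by auto
  ultimately show ?thesis unfolding crit by (simp add: conj_commute)
qed

text \<open>Corners of different colours lie in different regions, so injectivity and image can be
  checked for each colour separately.\<close>

lemma region_bij_split:
  assumes R: "colour R" and x: "x \<subseteq> darts D" and v: "v \<in> R" and u: "u \<in> regions D - R"
  defines "S \<equiv> regions D - R"
  shows "inj_on (region D) x \<and> region D ` x = regions D - {u, v} \<longleftrightarrow>
    inj_on (region D) (corners_in R x) \<and> region D ` corners_in R x = R - {v} \<and>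
    inj_on (region D) (corners_in S x) \<and> region D ` corners_in S x = S - {u}"
proof -
  have xs: "x = corners_in R x \<union> corners_in S x"
    using x region_in_regions by (auto simp: corners_in_def S_def)
  have img: "region D ` corners_in R x = region D ` x \<inter> R"
    "region D ` corners_in S x = region D ` x \<inter> S"
    by (auto simp: corners_in_def)
  have inj: "inj_on (region D) x \<longleftrightarrow>
      inj_on (region D) (corners_in R x) \<and> inj_on (region D) (corners_in S x)"
  proof -
    have "inj_on (region D) (corners_in R x \<union> corners_in S x) \<longleftrightarrow>
        inj_on (region D) (corners_in R x) \<and> inj_on (region D) (corners_in S x)"
      by (auto simp: inj_on_Un corners_in_def S_def)
    then show ?thesis by (simp only: xs[symmetric])
  qed
  have X: "region D ` x = region D ` x \<inter> R \<union> region D ` x \<inter> S"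
    using x region_in_regions by (auto simp: S_def)
  have Q: "R - {v} \<union> (S - {u}) = regions D - {u, v}" "(regions D - {u, v}) \<inter> R = R - {v}"
    "(regions D - {u, v}) \<inter> S = S - {u}"
    using colour_subset[OF R] v u by (auto simp: S_def)
  have "region D ` x = regions D - {u, v} \<longleftrightarrow>
      region D ` x \<inter> R = R - {v} \<and> region D ` x \<inter> S = S - {u}"
    using X Q by metis
  with inj img show ?thesis by auto
qed

text \<open>The dictionary between matchings with two critical cells and \<open>tree_pair\<close>.
  Acyclicity is stated for each colour here; its relation to \<open>modified_arrows\<close> is
  established separately.\<close>

lemma matching_critical_iff:
  assumes R: "colour R" and v: "v \<in> R" and u: "u \<in> regions D - R"
  shows "is_matching (overlaid_graph D) x \<and> critical D x = {Region u, Region v} \<and>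
      acyclic (step_rel (corners_in R x)) \<and> acyclic (step_rel (corners_in (regions D - R) x))
    \<longleftrightarrow> tree_pair R v u x"
proof (cases "x \<subseteq> darts D")
  case True
  have uv: "u \<in> regions D" "v \<in> regions D" using u v colour_subset[OF R] by auto
  have sub: "corners_in Q x \<subseteq> corners_in Q (darts D)" for Q
    using True by (auto simp: corners_in_def)
  have inj: "inj_on (crossing D) (corners_in Q x)" if "inj_on (crossing D) x" for Q
    using that by (rule inj_on_subset) (auto simp: corners_in_def)
  have "is_matching (overlaid_graph D) x \<and> critical D x = {Region u, Region v} \<longleftrightarrow>
      inj_on (crossing D) x \<and> crossing D ` x = crossings D \<and>
      (inj_on (region D) x \<and> region D ` x = regions D - {u, v})"
    using True by (auto simp: is_matching_overlaid_iff critical_eq_iff[OF True uv])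
  moreover have "tree_pair R v u x \<longleftrightarrow> inj_on (crossing D) x \<and> crossing D ` x = crossings D \<and>
      (inj_on (region D) (corners_in R x) \<and> region D ` corners_in R x = R - {v} \<and>
       inj_on (region D) (corners_in (regions D - R) x) \<and>
       region D ` corners_in (regions D - R) x = regions D - R - {u}) \<and>
      acyclic (step_rel (corners_in R x)) \<and> acyclic (step_rel (corners_in (regions D - R) x))"
    using True u v sub inj
    by (simp add: tree_pair_def tait_rooted_iff[OF R] tait_rooted_iff[OF colour_compl[OF R]])
      metis
  ultimately show ?thesis unfolding region_bij_split[OF R True v u] by argo
next
  case False
  then show ?thesis by (auto simp: is_matching_overlaid_iff tree_pair_def)
qed

section \<open>Acyclicity of the modified arrows\<close>

lemma across_notin:
  assumes "x \<subseteq> darts D" "inj_on (crossing D) x" "d \<in> x"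
  shows "across d \<notin> x"
proof
  assume "across d \<in> x"
  then have "across d = d"
    by (rule inj_onD[OF assms(2), rotated]) (simp_all add: crossing_rot assms(3))
  with assms four_corners(3) show False by auto
qed

text \<open>A step of a tree consists of two modified arrows through a crossing, one at its matched
  corner and one at the opposite corner. For black regions they lead from child to parent, for white
  regions from parent to child, whence the converse in the white case.\<close>

lemma acyclic_modified_arrowsD:
  assumes x: "x \<subseteq> darts D" "inj_on (crossing D) x" and acy: "acyclic (modified_arrows D x)"
  shows "acyclic (step_rel (corners_in (black D) x))"
    and "acyclic (step_rel (corners_in (white D) x))"
proof -
  let ?M = "modified_arrows D x"
  have M: "arrow D (across d) \<in> ?M" "(snd (arrow D d), fst (arrow D d)) \<in> ?M" if "d \<in> x" for d
    using that x across_notin[OF x that] by (auto simp: modified_arrows_def rot_darts)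
  have "(Region (region D d), Region (region D (across d))) \<in> ?M\<^sup>+"
    if "d \<in> corners_in (black D) x" for d
  proof -
    have d: "d \<in> x" "d \<in> darts D" "region D d \<in> black D"
      using that x by (auto simp: corners_in_def)
    have "(Region (region D d), Crossing (crossing D d)) \<in> ?M"
      "(Crossing (crossing D d), Region (region D (across d))) \<in> ?M"
      using M[OF d(1)] d region_across by (auto simp: arrow_def crossing_rot)
    then show ?thesis by (meson trancl.simps)
  qed
  then show "acyclic (step_rel (corners_in (black D) x))"
    by (intro acyclic_transport[OF acy, where f = Region]) (auto simp: step_rel_def)
  have "(Region (region D (across d)), Region (region D d)) \<in> ?M\<^sup>+"
    if "d \<in> corners_in (white D) x" for d
  proof -
    have d: "d \<in> x" "d \<in> darts D" "region D d \<notin> black D"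
      using that x by (auto simp: corners_in_def white_def)
    have "(Region (region D (across d)), Crossing (crossing D d)) \<in> ?M"
      "(Crossing (crossing D d), Region (region D d)) \<in> ?M"
      using M[OF d(1)] d region_across by (auto simp: arrow_def crossing_rot)
    then show ?thesis by (meson trancl.simps)
  qed
  then have "acyclic ((step_rel (corners_in (white D) x))\<inverse>)"
    by (intro acyclic_transport[OF acy, where f = Region]) (auto simp: step_rel_def)
  then show "acyclic (step_rel (corners_in (white D) x))" by simp
qed

text \<open>The modified arrows never lead from the black half (black regions and the crossings matched
  with them) to the white half, and each half is ranked by its tree.\<close>

lemma acyclic_modified_arrowsI:
  assumes x: "x \<subseteq> darts D" "inj_on (crossing D) x" "crossing D ` x = crossings D"
    and b: "acyclic (step_rel (corners_in (black D) x))"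
    and w: "acyclic (step_rel (corners_in (white D) x))"
  shows "acyclic (modified_arrows D x)"
proof -
  have fin: "finite (step_rel (corners_in R x))" for R
    using finite_subset[OF x(1) finite_darts] by (simp add: step_rel_def corners_in_def)
  obtain f :: "'d set \<Rightarrow> nat"
    where f: "\<forall>a c. (a, c) \<in> step_rel (corners_in (black D) x) \<longrightarrow> f c < f a"
    using finite_acyclic_decreasing[OF fin b] ..
  \<comment> \<open>In the white half the modified arrows descend from parent to child, so
    \<open>g\<close> has to decrease along the converse.\<close>
  have "finite ((step_rel (corners_in (white D) x))\<inverse>)"
    "acyclic ((step_rel (corners_in (white D) x))\<inverse>)" using fin w by auto
  from finite_acyclic_decreasing[OF this] obtain g :: "'d set \<Rightarrow> nat"
    where g: "\<forall>a c. (a, c) \<in> (step_rel (corners_in (white D) x))\<inverse> \<longrightarrow> g c < g a" ..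
  have f': "f (region D (across m)) < f (region D m)" if "m \<in> x" "region D m \<in> black D" for m
    using that by (intro f[rule_format]) (auto simp: step_rel_def corners_in_def)
  have g': "g (region D m) < g (region D (across m))" if "m \<in> x" "region D m \<notin> black D" for m
    using that x(1) region_in_regions
    by (intro g[rule_format]) (auto simp: step_rel_def corners_in_def white_def)
  \<comment> \<open>The bound \<open>N\<close> lifts the white half above every black rank.\<close>
  have "finite ((\<lambda>d. 2 * f (region D d)) ` darts D)" using finite_darts by simp
  then obtain N where N: "\<And>d. d \<in> darts D \<Longrightarrow> 2 * f (region D d) < N"
    unfolding finite_nat_set_iff_bounded by auto
  define m where "m = inv_into x (crossing D)"
  have m_eq: "m (crossing D d) = d" if "d \<in> x" for d
    unfolding m_def by (rule inv_into_f_f[OF x(2) that])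
  have m: "m (crossing D d) \<in> x" "crossing D (m (crossing D d)) = crossing D d"
    if "d \<in> darts D" for d
    using crossing_in_crossings[OF that] unfolding m_def x(3)[symmetric]
    by (rule inv_into_into, rule f_inv_into_f)
  \<comment> \<open>Doubling leaves room for the crossings: one matched with a black region ranks
    just below that region, one matched with a white region just above it. The subtraction does not
    truncate, since \<open>f'\<close> makes \<open>f\<close> positive at a matched black
    region.\<close>
  define rank :: "'d cell \<Rightarrow> nat" where "rank z = (case z of
      Region r \<Rightarrow> if r \<in> black D then 2 * f r else N + 2 * g r
    | Crossing c \<Rightarrow> if region D (m c) \<in> black D then 2 * f (region D (m c)) - 1
                    else N + 2 * g (region D (m c)) + 1)" for z
  have unmatched_arrow: "rank (snd (arrow D d)) < rank (fst (arrow D d))" if d: "d \<in> darts D - x" for d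
  proof -
    define k where "k = m (crossing D d)"
    have k: "k \<in> x" "crossing D k = crossing D d" "k \<in> darts D" "k \<noteq> d"
      using m[of d] d x(1) by (auto simp: k_def)
    have *: "d = across k" if "region D d \<in> black D \<longleftrightarrow> region D k \<in> black D"
      using same_crossing[of d k] that k d by auto
    then have "f (region D d) < f (region D k)" if "region D d \<in> black D" "region D k \<in> black D"
      using that f'[OF k(1)] by simp
    moreover have "g (region D k) < g (region D d)"
      if "region D d \<notin> black D" "region D k \<notin> black D"
      using that * g'[OF k(1)] by simp
    ultimately show ?thesis
      using N[OF k(3)] N[of d] d
      by (cases "region D d \<in> black D"; cases "region D k \<in> black D")
        (auto simp: arrow_def rank_def k_def[symmetric])
  qed
  have matched_arrow: "rank (fst (arrow D d)) < rank (snd (arrow D d))" if d: "d \<in> x" for d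
    using f'[OF d] m_eq[OF d] by (auto simp: arrow_def rank_def)
  show ?thesis
  proof (rule acyclic_if_decreasing[where f = rank])
    fix a c assume "(a, c) \<in> modified_arrows D x"
    then consider d where "d \<in> darts D - x" "(a, c) = arrow D d"
      | d where "d \<in> x" "(c, a) = arrow D d"
      by (auto simp: modified_arrows_def)
    then show "rank c < rank a"
      by cases (metis unmatched_arrow matched_arrow fst_conv snd_conv)+
  qed
qed

lemma perfect_morse_iff:
  assumes "vw \<in> white D" "vb \<in> black D"
  shows "x \<in> perfect_morse D vw vb \<longleftrightarrow> tree_pair (black D) vb vw x"
proof -
  have white: "regions D - black D = white D" by (simp add: white_def)
  have "x \<in> perfect_morse D vw vb \<longleftrightarrow> is_matching (overlaid_graph D) x \<and>
      critical D x = {Region vw, Region vb} \<and> acyclic (modified_arrows D x)"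
    by (auto simp: perfect_morse_def discrete_morse_def)
  also have "\<dots> \<longleftrightarrow> is_matching (overlaid_graph D) x \<and> critical D x = {Region vw, Region vb} \<and>
      acyclic (step_rel (corners_in (black D) x)) \<and> acyclic (step_rel (corners_in (white D) x))"
  proof -
    have "acyclic (modified_arrows D x) \<longleftrightarrow>
        acyclic (step_rel (corners_in (black D) x)) \<and> acyclic (step_rel (corners_in (white D) x))"
      if "is_matching (overlaid_graph D) x" "critical D x = {Region vw, Region vb}"
    proof -
      have x: "x \<subseteq> darts D" "inj_on (crossing D) x"
        using that(1) by (auto simp: is_matching_overlaid_iff)
      moreover have "crossing D ` x = crossings D"
        using critical_eq_iff[OF x(1), of vw vb] that(2) assms black_subset by (auto simp: white_def)
      ultimately show ?thesis
        using acyclic_modified_arrowsD[OF x] acyclic_modified_arrowsI[OF x] by blast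
    qed
    then show ?thesis by blast
  qed
  also have "\<dots> \<longleftrightarrow> tree_pair (black D) vb vw x"
    using matching_critical_iff[of "black D" vb vw x] assms white by (simp add: colour_def)
  finally show ?thesis .
qed

section \<open>Click path moves on pairs of trees\<close>

text \<open>Every crossing is used once, so the edges of one tree determine those of the other;
  edges and root then determine each tree.\<close>

lemma tree_pair_unique:
  assumes R: "colour R" and x: "tree_pair R v u x" and y: "tree_pair R v u y"
    and eq: "crossing D ` corners_in R x = crossing D ` corners_in R y"
  shows "x = y"
proof -
  let ?S = "regions D - R"
  have split: "z = corners_in R z \<union> corners_in ?S z" if "z \<subseteq> darts D" for z
    using that region_in_regions by (auto simp: corners_in_def)
  have compl: "crossing D ` corners_in ?S z = crossings D - crossing D ` corners_in R z"
    if "tree_pair R v u z" for z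
  proof -
    have z: "z \<subseteq> darts D" "inj_on (crossing D) z" "crossing D ` z = crossings D"
      using that by (auto simp: tree_pair_def)
    have "corners_in ?S z = z - corners_in R z"
      using z(1) region_in_regions by (auto simp: corners_in_def)
    moreover have "corners_in R z \<subseteq> z" by (auto simp: corners_in_def)
    ultimately show ?thesis using z inj_on_image_set_diff[OF z(2), of z] by auto
  qed
  have "corners_in R x = corners_in R y"
    using x y eq unfolding tree_pair_def
    by (intro half_edge_graph.rooted_unique[OF half_edge_graph_tait[OF R]]) auto
  moreover have "corners_in ?S x = corners_in ?S y"
  proof (rule half_edge_graph.rooted_unique[OF half_edge_graph_tait[OF colour_compl[OF R]]])
    show "tait_rooted ?S u (corners_in ?S x)" "tait_rooted ?S u (corners_in ?S y)"
      using x y by (simp_all add: tree_pair_def)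
    show "crossing D ` corners_in ?S x = crossing D ` corners_in ?S y"
      using compl[OF x] compl[OF y] eq by simp
  qed
  ultimately show ?thesis using split x y unfolding tree_pair_def by metis
qed

text \<open>The tree on \<open>R\<close> is rerooted at \<open>v'\<close> and the other one is kept.
  Rerooting preserves the set of crossings used, so the union still pairs each crossing exactly
  once.\<close>

lemma tree_pair_click:
  assumes R: "colour R" and x: "tree_pair R v u x" and v': "v' \<in> R"
  obtains x' where "tree_pair R v' u x'" "click_on D R x x'"
proof -
  let ?S = "regions D - R" and ?T = "matched_subgraph D R x"
  note tait = half_edge_graph_tait[OF R]
  have xD: "x \<subseteq> darts D" and inj: "inj_on (crossing D) x"
    and xR: "tait_rooted R v (corners_in R x)" and xS: "tait_rooted ?S u (corners_in ?S x)"
    using x by (auto simp: tree_pair_def)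
  have T: "matched_subgraph D R z = (tait_graph D R)\<lparr>edges := crossing D ` corners_in R z\<rparr>" for z
    by (simp add: matched_subgraph_def corners_in_def)
  have "v' \<in> verts (tait_graph D R)" using v' by (simp add: tait_graph_def)
  from half_edge_graph.rooted_reroot[OF tait xR this] obtain z p
    where z: "tait_rooted R v' z" and img: "crossing D ` z = crossing D ` corners_in R x"
      and p: "is_path ?T v p v'"
      and agree: "{h \<in> corners_in R x. crossing D h \<notin> set (map fst p)} =
        {h \<in> z. crossing D h \<notin> set (map fst p)}"
    unfolding T by blast
  define x' where "x' = z \<union> corners_in ?S x"
  have zR: "z \<subseteq> corners_in R (darts D)"
    using half_edge_graph.rooted_subset[OF tait z] .
  have split: "x = corners_in R x \<union> corners_in ?S x"
    using xD region_in_regions by (auto simp: corners_in_def)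
  have parts: "corners_in R x' = z" "corners_in ?S x' = corners_in ?S x"
    using zR by (auto simp: x'_def corners_in_def)
  have cr: "crossing D ` x' = crossing D ` x"
    unfolding x'_def image_Un img by (subst (3) split) (simp add: image_Un)
  have "crossing D ` z \<inter> crossing D ` corners_in ?S x = {}"
    unfolding img using inj by (auto simp: corners_in_def dest: inj_onD)
  moreover have "inj_on (crossing D) z" "inj_on (crossing D) (corners_in ?S x)"
    using z xS tait_rooted_iff[OF R] tait_rooted_iff[OF colour_compl[OF R]] by auto
  ultimately have "inj_on (crossing D) x'"
    unfolding x'_def by (auto simp: inj_on_Un)
  moreover have "x' \<subseteq> darts D" using zR xD by (auto simp: x'_def corners_in_def)
  ultimately have x': "tree_pair R v' u x'"
    using x z xS cr parts by (simp add: tree_pair_def)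
  have v: "v \<in> R" using xR tait_rooted_iff[OF R] by simp
  have u: "u \<in> ?S" using xS tait_rooted_iff[OF colour_compl[OF R]] by simp
  note mc = matching_critical_iff[OF R v u, of x] matching_critical_iff[OF R v' u, of x']
  have eq: "?T = matched_subgraph D R x'" unfolding T parts img ..
  have tree: "is_tree ?T" unfolding T by (rule half_edge_graph.rooted_is_tree[OF tait xR])
  have "{d \<in> x. crossing D d \<notin> set (map fst p)} = {d \<in> x'. crossing D d \<notin> set (map fst p)}"
    unfolding x'_def using agree split by blast
  with p tree eq mc x x' u v v' have "click_on D R x x'"
    unfolding click_on_def by blast
  with x' that show ?thesis by blast
qed

text \<open>The first equation is part of the definition of a move. The second follows by taking
  complements, since both matchings pair all crossings.\<close>

lemma click_on_crossings:
  assumes R: "colour R" and click: "click_on D R x x'"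
  shows "crossing D ` corners_in R x = crossing D ` corners_in R x'"
    and "crossing D ` corners_in (regions D - R) x = crossing D ` corners_in (regions D - R) x'"
proof -
  let ?S = "regions D - R"
  from click obtain u v v' where uv: "u \<in> regions D - R" "v \<in> R" "v' \<in> R"
    and crit: "critical D x = {Region u, Region v}" "critical D x' = {Region u, Region v'}"
    and mat: "is_matching (overlaid_graph D) x" "is_matching (overlaid_graph D) x'"
    and eq: "matched_subgraph D R x = matched_subgraph D R x'"
    unfolding click_on_def by blast
  have "edges (matched_subgraph D R x) = edges (matched_subgraph D R x')" using eq by simp
  then show R_eq: "crossing D ` corners_in R x = crossing D ` corners_in R x'"
    by (simp add: matched_subgraph_def corners_in_def)
  have compl: "crossing D ` corners_in ?S z = crossings D - crossing D ` corners_in R z"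
    if "is_matching (overlaid_graph D) z" "critical D z = {Region u, Region w}" "w \<in> R" for z w
  proof -
    have z: "z \<subseteq> darts D" "inj_on (crossing D) z"
      using that(1) by (auto simp: is_matching_overlaid_iff)
    have "crossing D ` z = crossings D"
      using critical_eq_iff[OF z(1), of u w] that uv(1) colour_subset[OF R] by auto
    moreover have "corners_in ?S z = z - corners_in R z"
      using z(1) region_in_regions by (auto simp: corners_in_def)
    moreover have "corners_in R z \<subseteq> z" by (auto simp: corners_in_def)
    ultimately show ?thesis using inj_on_image_set_diff[OF z(2), of z] by auto
  qed
  show "crossing D ` corners_in ?S x = crossing D ` corners_in ?S x'"
    using compl mat crit uv R_eq by simp
qed

lemma click_path_move_crossings:
  assumes "click_path_move D x x'"
  shows "crossing D ` corners_in (black D) x = crossing D ` corners_in (black D) x'"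
proof -
  have "regions D - white D = black D" using black_subset by (auto simp: white_def)
  then show ?thesis
    using assms click_on_crossings(1)[of "black D" x x'] click_on_crossings(2)[of "white D" x x']
    by (auto simp: click_path_move_def colour_def)
qed

lemma click_path_moves_crossings:
  assumes "(click_path_move D)\<^sup>*\<^sup>* x x'"
  shows "crossing D ` corners_in (black D) x = crossing D ` corners_in (black D) x'"
  using assms by induction (auto dest: click_path_move_crossings)

text \<open>One black move is followed by one white move. Where a root does not change, the move is
  the trivial one along the empty path, so the count is always two.\<close>

lemma perfect_morse_two_clicks:
  assumes v: "vw \<in> white D" "vb \<in> black D" "vw' \<in> white D" "vb' \<in> black D"
    and x: "x \<in> perfect_morse D vw vb"
  obtains y where "y \<in> perfect_morse D vw' vb'" "(click_path_move D ^^ 2) x y"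
proof -
  have colour: "colour (black D)" "colour (white D)"
    and wb: "regions D - black D = white D"
    by (simp_all add: colour_def white_def)
  have "tree_pair (black D) vb vw x" using x perfect_morse_iff v by simp
  from tree_pair_click[OF colour(1) this v(4)] obtain z
    where z: "tree_pair (black D) vb' vw z" "click_on D (black D) x z" by blast
  have "tree_pair (white D) vw vb' z" using z(1) tree_pair_swap[OF colour(1)] wb by simp
  from tree_pair_click[OF colour(2) this v(3)] obtain y
    where y: "tree_pair (white D) vw' vb' y" "click_on D (white D) z y" by blast
  have "tree_pair (black D) vb' vw' y" using y(1) tree_pair_swap[OF colour(1)] wb by simp
  then have "y \<in> perfect_morse D vw' vb'" using perfect_morse_iff v by simp
  moreover have "(click_path_move D ^^ 2) x y"
    using z(2) y(2) by (auto simp: numeral_2_eq_2 click_path_move_def relcompp_apply)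
  ultimately show ?thesis by (rule that)
qed

lemma perfect_morse_unique:
  assumes "vw \<in> white D" "vb \<in> black D" "x \<in> perfect_morse D vw vb" "y \<in> perfect_morse D vw vb"
    and "crossing D ` corners_in (black D) x = crossing D ` corners_in (black D) y"
  shows "x = y"
  using assms perfect_morse_iff tree_pair_unique[of "black D" vb vw x y] by (simp add: colour_def)

end

theorem proposition6p3:
  fixes D :: "'d diagram" and vw vw' vb vb' :: "'d set"
  assumes "knot_diagram D" and "reduced D"
    and "vw \<in> verts (white_graph D)" and "vb \<in> verts (black_graph D)"
    and "vw' \<in> verts (white_graph D)" and "vb' \<in> verts (black_graph D)"
  shows "\<exists>f. bij_betw f (perfect_morse D vw vb) (perfect_morse D vw' vb') \<and>
    (\<forall>x \<in> perfect_morse D vw vb. \<forall>y \<in> perfect_morse D vw' vb'.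
       (click_path_move D)\<^sup>*\<^sup>* x y \<longleftrightarrow> y = f x) \<and>
    (\<forall>x \<in> perfect_morse D vw vb. \<exists>n\<le>2. (click_path_move D ^^ n) x (f x))"
proof -
  interpret reduced_diagram D using assms(1,2) by unfold_locales
  have v: "vw \<in> white D" "vb \<in> black D" "vw' \<in> white D" "vb' \<in> black D"
    using assms(3-6) by (auto simp: tait_graph_def)
  let ?P = "perfect_morse D vw vb" and ?P' = "perfect_morse D vw' vb'"
  let ?c = "\<lambda>x. crossing D ` corners_in (black D) x"
  have "\<forall>x\<in>?P. \<exists>y. y \<in> ?P' \<and> (click_path_move D ^^ 2) x y"
    using perfect_morse_two_clicks[OF v] by blast
  \<comment> \<open>An arbitrary choice of images suffices, because \<open>fI\<close> shows that the
    invariant \<open>?c\<close> leaves only one candidate.\<close>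
  then obtain f where f: "\<And>x. x \<in> ?P \<Longrightarrow> f x \<in> ?P'"
    "\<And>x. x \<in> ?P \<Longrightarrow> (click_path_move D ^^ 2) x (f x)"
    by metis
  have c: "?c x = ?c y" if "(click_path_move D ^^ n) x y" for x y n
    using click_path_moves_crossings[OF relpowp_imp_rtranclp[OF that]] .
  have fI: "y = f x" if "x \<in> ?P" "y \<in> ?P'" "?c x = ?c y" for x y
    using perfect_morse_unique[OF v(3,4) that(2) f(1)[OF that(1)]] c[OF f(2)[OF that(1)]] that(3)
    by simp
  have "inj_on f ?P"
  proof (rule inj_onI)
    fix x y assume xy: "x \<in> ?P" "y \<in> ?P" "f x = f y"
    then have "?c x = ?c y" using c[OF f(2)[of x]] c[OF f(2)[of y]] by simp
    with xy show "x = y" using perfect_morse_unique[OF v(1,2)] by blast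
  qed
  \<comment> \<open>Two moves from \<open>y\<close> back to the old roots give an \<open>x\<close>
    with the same invariant, and \<open>fI\<close> identifies \<open>y\<close> with its
    image.\<close>
  moreover have "y \<in> f ` ?P" if y: "y \<in> ?P'" for y
  proof -
    obtain x where "x \<in> ?P" "(click_path_move D ^^ 2) y x"
      using perfect_morse_two_clicks[OF v(3,4,1,2) y] by blast
    with y fI c show ?thesis by (metis image_eqI)
  qed
  ultimately have bij: "bij_betw f ?P ?P'" using f(1) by (auto simp: bij_betw_def)
  \<comment> \<open>Sequences of moves of any length, through any intermediate roots, preserve
    \<open>?c\<close> and so can only end at \<open>f x\<close>.\<close>
  have "(click_path_move D)\<^sup>*\<^sup>* x y \<longleftrightarrow> y = f x" if "x \<in> ?P" "y \<in> ?P'" for x y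
    using fI[OF that] click_path_moves_crossings relpowp_imp_rtranclp[OF f(2)[OF that(1)]] by blast
  with bij f(2) show ?thesis by blast
qed

end
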